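(* Let $A=[\xi_{ij}]_{n\times n}\in\mathbb{C}_2^{n\times n}$ be a bicomplex matrix. If either the rows of $1_A$ (respectively $2_A$) or the columns of $1_A$ (respectively $2_A$) are linearly independent over $\mathbb{C}_1$, then $\rho_r(A)=\rho_c(A)=n$.
   Context: $\mathbb{C}_1$ denotes the complex numbers (imaginary unit $i_1$). $\mathbb{C}_2=\{z_1+i_2z_2: z_1,z_2\in\mathbb{C}_1\}$ is the commutative ring of bicomplex numbers, where $i_1i_2=i_2i_1$, $i_1^2=i_2^2=-1$. Put $e_1=\frac{1+i_1i_2}{2}$, $e_2=\frac{1-i_1i_2}{2}$; every $\xi\in\mathbb{C}_2$ is uniquely $\xi=1_\xi e_1+2_\xi e_2$ with $1_\xi,2_\xi\in\mathbb{C}_1$, and operations are component-wise in this representation. For $A=[\xi_{ij}]\in\mathbb{C}_2^{n\times m}$ put $1_A=[1_{\xi_{ij}}]$, $2_A=[2_{\xi_{ij}}]\in\mathbb{C}_1^{n\times m}$, so $A=1_Ae_1+2_Ae_2$ uniquely. Row rank $\rho_r(A)$: the dimension over $\mathbb{C}_1$ of the $\mathbb{C}_1$-subspace of $\mathbb{C}_2^m$ spanned (with scalars in $\mathbb{C}_1$) by the rows of $A$. Column rank $\rho_c(A)$: the dimension over $\mathbb{C}_1$ of the $\mathbb{C}_1$-subspace of $\mathbb{C}_2^n$ spanned by the columns of $A$. *)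

theory Defs
  imports "HOL-Analysis.Analysis"
begin

section \<open>Bicomplex numbers\<close>

text \<open>\<open>Bicomplex z w\<close> stands for \<open>z + i\<^sub>2 w\<close>; the first imaginary unit \<open>i\<^sub>1\<close> is that of \<^typ>\<open>complex\<close>.\<close>

datatype bicomplex = Bicomplex (bc_fst: complex) (bc_snd: complex)

instantiation bicomplex :: comm_ring_1
begin

definition "0 = Bicomplex 0 0"
definition "1 = Bicomplex 1 0"
definition "x + y = Bicomplex (bc_fst x + bc_fst y) (bc_snd x + bc_snd y)"
definition "x - y = Bicomplex (bc_fst x - bc_fst y) (bc_snd x - bc_snd y)"
definition "- x = Bicomplex (- bc_fst x) (- bc_snd x)"
definition "x * y = Bicomplex (bc_fst x * bc_fst y - bc_snd x * bc_snd y)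
                              (bc_fst x * bc_snd y + bc_snd x * bc_fst y)"

lemmas bicomplex_defs =
  zero_bicomplex_def one_bicomplex_def plus_bicomplex_def minus_bicomplex_def
  uminus_bicomplex_def times_bicomplex_def

instance
  by standard (auto simp: bicomplex_defs algebra_simps intro: bicomplex.expand)

end

definition bc_of_complex :: "complex \<Rightarrow> bicomplex" where
  "bc_of_complex z = Bicomplex z 0"

definition bc_i1 :: bicomplex where
  "bc_i1 = bc_of_complex \<i>"

definition bc_i2 :: bicomplex where
  "bc_i2 = Bicomplex 0 1"

lemma bicomplex_units:
  "bc_i1 * bc_i1 = - 1" "bc_i2 * bc_i2 = - 1" "bc_i1 * bc_i2 = bc_i2 * bc_i1"
  by (simp_all add: bc_i1_def bc_i2_def bc_of_complex_def bicomplex_defs)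

lemma Bicomplex_eq: "Bicomplex z w = bc_of_complex z + bc_i2 * bc_of_complex w"
  by (simp add: bc_i2_def bc_of_complex_def bicomplex_defs)

lemma bc_of_complex_hom:
  "bc_of_complex 0 = 0" "bc_of_complex 1 = 1"
  "bc_of_complex (a + b) = bc_of_complex a + bc_of_complex b"
  "bc_of_complex (a * b) = bc_of_complex a * bc_of_complex b"
  by (simp_all add: bc_of_complex_def bicomplex_defs)

section \<open>Idempotent representation\<close>

definition bc_e1 :: bicomplex where
  "bc_e1 = bc_of_complex (1 / 2) * (1 + bc_i1 * bc_i2)"

definition bc_e2 :: bicomplex where
  "bc_e2 = bc_of_complex (1 / 2) * (1 - bc_i1 * bc_i2)"

text \<open>
  The components \<open>1\<^sub>\<xi>\<close> and \<open>2\<^sub>\<xi>\<close>: solving \<open>z + i\<^sub>2 w = a e\<^sub>1 + b e\<^sub>2\<close> gives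
  \<open>a = z - i\<^sub>1 w\<close> and \<open>b = z + i\<^sub>1 w\<close>; see \<open>idempotent_representation_iff\<close> below.
\<close>

definition idem1 :: "bicomplex \<Rightarrow> complex" where
  "idem1 \<xi> = bc_fst \<xi> - \<i> * bc_snd \<xi>"

definition idem2 :: "bicomplex \<Rightarrow> complex" where
  "idem2 \<xi> = bc_fst \<xi> + \<i> * bc_snd \<xi>"

lemma idempotent_representation_iff:
  "\<xi> = bc_of_complex a * bc_e1 + bc_of_complex b * bc_e2 \<longleftrightarrow> a = idem1 \<xi> \<and> b = idem2 \<xi>"
proof -
  have "bc_of_complex a * bc_e1 + bc_of_complex b * bc_e2
      = Bicomplex ((a + b) / 2) (\<i> * (a - b) / 2)"
    by (simp add: bc_e1_def bc_e2_def bc_i1_def bc_i2_def bc_of_complex_def bicomplex_defs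
        field_simps)
  moreover have "\<xi> = Bicomplex ((a + b) / 2) (\<i> * (a - b) / 2)
      \<longleftrightarrow> a = idem1 \<xi> \<and> b = idem2 \<xi>"
  proof
    assume "\<xi> = Bicomplex ((a + b) / 2) (\<i> * (a - b) / 2)"
    then show "a = idem1 \<xi> \<and> b = idem2 \<xi>"
      by (simp add: idem1_def idem2_def field_simps)
  next
    assume "a = idem1 \<xi> \<and> b = idem2 \<xi>"
    then have a: "a = bc_fst \<xi> - \<i> * bc_snd \<xi>" and b: "b = bc_fst \<xi> + \<i> * bc_snd \<xi>"
      by (simp_all only: idem1_def idem2_def)
    have "a + b = 2 * bc_fst \<xi>" "\<i> * (a - b) = 2 * bc_snd \<xi>"
      unfolding a b by (simp_all add: algebra_simps)
    then show "\<xi> = Bicomplex ((a + b) / 2) (\<i> * (a - b) / 2)"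
      by simp
  qed
  ultimately show ?thesis by simp
qed

lemma idem_componentwise:
  "idem1 (x + y) = idem1 x + idem1 y" "idem2 (x + y) = idem2 x + idem2 y"
  "idem1 (x * y) = idem1 x * idem1 y" "idem2 (x * y) = idem2 x * idem2 y"
  by (simp_all add: idem1_def idem2_def bicomplex_defs algebra_simps)

definition mat_idem1 :: "bicomplex ^ 'm ^ 'n \<Rightarrow> complex ^ 'm ^ 'n" where
  "mat_idem1 A = (\<chi> i j. idem1 (A $ i $ j))"

definition mat_idem2 :: "bicomplex ^ 'm ^ 'n \<Rightarrow> complex ^ 'm ^ 'n" where
  "mat_idem2 A = (\<chi> i j. idem2 (A $ i $ j))"

section \<open>Bicomplex vectors as a complex vector space; row and column rank\<close>

definition cvec_scale :: "complex \<Rightarrow> bicomplex ^ 'm \<Rightarrow> bicomplex ^ 'm" where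
  "cvec_scale c v = bc_of_complex c *s v"

interpretation bcvec: vector_space "cvec_scale :: complex \<Rightarrow> bicomplex ^ 'm \<Rightarrow> bicomplex ^ 'm"
  by unfold_locales
    (simp_all add: cvec_scale_def vec_eq_iff bc_of_complex_hom algebra_simps)

definition row_rank :: "bicomplex ^ 'm ^ 'n \<Rightarrow> nat" where
  "row_rank A = bcvec.dim (bcvec.span (rows A))"

definition column_rank :: "bicomplex ^ 'm ^ 'n \<Rightarrow> nat" where
  "column_rank A = bcvec.dim (bcvec.span (columns A))"

section \<open>Linear independence of the rows or columns of a complex matrix\<close>

text \<open>
  Independence is that of the indexed family, not of the set of its values: a matrix with
  a repeated row has dependent rows although \<^const>\<open>rows\<close> collapses the repetition.
\<close>

definition lin_indep_family :: "('i::finite \<Rightarrow> complex ^ 'm) \<Rightarrow> bool" where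
  "lin_indep_family v \<longleftrightarrow>
     (\<forall>c :: 'i \<Rightarrow> complex. (\<Sum>i\<in>UNIV. c i *s v i) = 0 \<longrightarrow> (\<forall>i. c i = 0))"

lemma lin_indep_family_iff:
  "lin_indep_family v \<longleftrightarrow> inj v \<and> vec.independent (range v)"
proof (intro iffI conjI)
  assume v: "lin_indep_family v"
  show inj: "inj v"
  proof (rule injI, rule ccontr)
    fix i j
    assume eq: "v i = v j" and ne: "i \<noteq> j"
    define c :: "'a \<Rightarrow> complex" where "c k = (if k = i then 1 else if k = j then - 1 else 0)" for k
    have "(\<Sum>k\<in>UNIV. c k *s v k) = (\<Sum>k\<in>{i, j}. c k *s v k)"
      by (rule sum.mono_neutral_right) (auto simp: c_def)
    also have "\<dots> = 0"
      using ne eq by (simp add: c_def)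
    finally have "c i = 0"
      using v by (auto simp: lin_indep_family_def)
    then show False by (simp add: c_def)
  qed
  show "vec.independent (range v)"
  proof
    assume "vec.dependent (range v)"
    then obtain u where u: "\<exists>x\<in>range v. u x \<noteq> 0" "(\<Sum>x\<in>range v. u x *s x) = 0"
      by (auto simp: vec.dependent_finite)
    have "(\<Sum>i\<in>UNIV. u (v i) *s v i) = 0"
      using u(2) by (simp add: sum.reindex[OF inj])
    then have "\<forall>i. u (v i) = 0"
      using v[unfolded lin_indep_family_def, rule_format, of "\<lambda>i. u (v i)"] by simp
    with u(1) show False by auto
  qed
next
  assume *: "inj v \<and> vec.independent (range v)"
  then have inj: "inj v" by simp
  show "lin_indep_family v"
    unfolding lin_indep_family_def
  proof (intro allI impI)
    fix c i
    assume c: "(\<Sum>i\<in>UNIV. c i *s v i) = 0"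
    have "(\<Sum>x\<in>range v. c (inv v x) *s x) = 0"
      using c by (simp add: sum.reindex[OF inj] inv_f_f[OF inj])
    moreover have "\<forall>u. (\<Sum>x\<in>range v. u x *s x) = 0 \<longrightarrow> (\<forall>x\<in>range v. u x = 0)"
      using * by (auto simp: vec.dependent_finite)
    ultimately have "\<forall>x\<in>range v. c (inv v x) = 0"
      by (elim allE[of _ "\<lambda>x. c (inv v x)"]) simp
    then show "c i = 0"
      by (simp add: inv_f_f[OF inj])
  qed
qed

definition rows_independent :: "complex ^ 'm ^ 'n \<Rightarrow> bool" where
  "rows_independent M \<longleftrightarrow> lin_indep_family (\<lambda>i. row i M)"

definition columns_independent :: "complex ^ 'm ^ 'n \<Rightarrow> bool" where
  "columns_independent M \<longleftrightarrow> lin_indep_family (\<lambda>j. column j M)"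

end

theory Submission
  imports Defs
begin

text \<open>
  Each idempotent component induces a \<open>\<complex>\<^sub>1\<close>-linear map from bicomplex to complex vectors, and a
  linear map reflects linear independence. For a square complex matrix, independence of the rows
  and of the columns are both equivalent to invertibility.
\<close>

lemma rows_independent_iff_columns_independent:
  fixes M :: "complex ^ 'n ^ 'n"
  shows "rows_independent M \<longleftrightarrow> columns_independent M"
proof -
  have "rows_independent M \<longleftrightarrow> (\<exists>B. M ** B = mat 1)"
    by (simp add: rows_independent_def lin_indep_family_def matrix_right_invertible_independent_rows)
  moreover have "columns_independent M \<longleftrightarrow> (\<exists>B. B ** M = mat 1)"
    by (simp add: columns_independent_def lin_indep_family_def
        matrix_left_invertible_independent_columns)
  \<comment> \<open>Rows yield a right inverse, columns a left one; for a square matrix a one-sided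
    inverse is two-sided.\<close>
  ultimately show ?thesis
    using matrix_left_right_inverse by metis
qed

text \<open>Applied entrywise, the \<complex>-linear \<open>h\<close> turns a relation among the
  \<open>v i\<close> into one with the same coefficients among their images, so these all vanish.
  Keeping \<open>h\<close> abstract covers both idempotent components, for rows and columns
  alike.\<close>

lemma dim_span_range_eq_card:
  fixes v :: "'i::finite \<Rightarrow> bicomplex ^ 'm" and h :: "bicomplex \<Rightarrow> complex"
  assumes add: "\<And>x y. h (x + y) = h x + h y"
    and scale: "\<And>c x. h (bc_of_complex c * x) = c * h x"
    and indep: "lin_indep_family (\<lambda>i. \<chi> j. h (v i $ j))"
  shows "bcvec.dim (bcvec.span (range v)) = CARD('i)"
proof -
  have h0: "h 0 = 0"
    using add[of 0 0] by simp
  have h_sum: "h (\<Sum>i\<in>S. f i) = (\<Sum>i\<in>S. h (f i))" for S :: "'i set" and f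
    by (induction S rule: infinite_finite_induct) (simp_all add: h0 add)
  have coeffs_zero: "c i = 0" if "(\<Sum>i\<in>UNIV. cvec_scale (c i) (v i)) = 0" for c i
  proof -
    have "(\<Sum>i\<in>UNIV. bc_of_complex (c i) * v i $ j) = 0" for j
      using arg_cong[OF that, of "\<lambda>w. w $ j"] by (simp add: cvec_scale_def)
    then have "(\<Sum>i\<in>UNIV. c i * h (v i $ j)) = 0" for j
      using h_sum[of "\<lambda>i. bc_of_complex (c i) * v i $ j" UNIV] by (simp add: scale h0)
    then have "(\<Sum>i\<in>UNIV. c i *s (\<chi> j. h (v i $ j))) = 0"
      by (simp add: vec_eq_iff)
    then show ?thesis
      using indep by (simp add: lin_indep_family_def)
  qed
  \<comment> \<open>Injectivity passes from the images back to \<open>v\<close>, so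
    \<open>range v\<close> has exactly \<open>CARD('i)\<close> elements and sums over it can be
    reindexed by \<open>'i\<close>.\<close>
  have "inj (\<lambda>i. \<chi> j. h (v i $ j))"
    using indep by (simp add: lin_indep_family_iff)
  then have inj: "inj v"
    by (auto simp: inj_def)
  have "bcvec.independent (range v)"
  proof
    assume "bcvec.dependent (range v)"
    then obtain u where "\<exists>x\<in>range v. u x \<noteq> 0" "(\<Sum>x\<in>range v. cvec_scale (u x) x) = 0"
      by (auto simp: bcvec.dependent_finite)
    then show False
      using coeffs_zero[of "\<lambda>i. u (v i)"] by (auto simp: sum.reindex[OF inj])
  qed
  then show ?thesis
    by (simp add: bcvec.dim_span bcvec.dim_eq_card_independent card_image[OF inj])
qed

text \<open>Squareness lets either kind of independence supply the other, so one assumption controls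
  both ranks.\<close>

lemma ranks_eq_card:
  fixes A :: "bicomplex ^ 'n ^ 'n" and h :: "bicomplex \<Rightarrow> complex"
  assumes add: "\<And>x y. h (x + y) = h x + h y"
    and scale: "\<And>c x. h (bc_of_complex c * x) = c * h x"
    and indep: "rows_independent (\<chi> i j. h (A $ i $ j)) \<or> columns_independent (\<chi> i j. h (A $ i $ j))"
  shows "row_rank A = CARD('n) \<and> column_rank A = CARD('n)"
proof
  have "rows_independent (\<chi> i j. h (A $ i $ j))"
    using indep by (simp add: rows_independent_iff_columns_independent)
  then have "lin_indep_family (\<lambda>i. \<chi> j. h (row i A $ j))"
    by (simp add: rows_independent_def row_def)
  from dim_span_range_eq_card[OF add scale this] show "row_rank A = CARD('n)"
    by (simp add: row_rank_def rows_def full_SetCompr_eq)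
  have "columns_independent (\<chi> i j. h (A $ i $ j))"
    using indep by (simp add: rows_independent_iff_columns_independent)
  then have "lin_indep_family (\<lambda>j. \<chi> i. h (column j A $ i))"
    by (simp add: columns_independent_def column_def)
  from dim_span_range_eq_card[OF add scale this] show "column_rank A = CARD('n)"
    by (simp add: column_rank_def columns_def full_SetCompr_eq)
qed

theorem corollary2p35:
  fixes A :: "bicomplex ^ 'n ^ 'n"
  assumes "rows_independent (mat_idem1 A) \<or> columns_independent (mat_idem1 A) \<or>
           rows_independent (mat_idem2 A) \<or> columns_independent (mat_idem2 A)"
  shows "row_rank A = CARD('n) \<and> column_rank A = CARD('n)"
proof -
  have scale: "idem1 (bc_of_complex c * x) = c * idem1 x" "idem2 (bc_of_complex c * x) = c * idem2 x"
    for c x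
    \<comment> \<open>Both idempotent components of a complex scalar \<open>c\<close> equal
      \<open>c\<close>, since \<open>bc_e1 + bc_e2 = 1\<close>; multiplicativity then gives
      homogeneity.\<close>
    by (simp_all add: idem_componentwise) (simp_all add: idem1_def idem2_def bc_of_complex_def)
  show ?thesis
    using assms ranks_eq_card[of idem1, OF idem_componentwise(1) scale(1)]
      ranks_eq_card[of idem2, OF idem_componentwise(2) scale(2)]
    unfolding mat_idem1_def mat_idem2_def by blast
qed

end
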